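(* Let $(\gamma,D,\mathcal P)$ be a configuration over contexts $\Gamma;\Delta$, and let $X_1,\dots,X_n$ be random expressions over $\Gamma;\Delta$, with $X_i$ of type $A_i$. Write $X_i'=X_i(\gamma)\circ D$. Then the random variables $X_1',\dots,X_n'$ are mutually independent with respect to $\mathcal P$ if and only if $(\gamma,D,\mathcal P)\vDash \mathsf{own}\,X_1*\cdots*\mathsf{own}\,X_n$.
   Context: Fix an ambient measurable space $(\Omega,\Sigma_\Omega)$. Probability spaces here are pairs $(\mathcal F,\mu)$ with $\mathcal F\subseteq\Sigma_\Omega$ a sub-$\sigma$-algebra and $\mu$ a probability measure on $\mathcal F$. Write $(\mathcal F,\mu)\sqsubseteq(\mathcal G,\nu)$ iff $\mathcal F\subseteq\mathcal G$ and $\mu=\nu|_{\mathcal F}$. The independent combination $(\mathcal E,\mu)\bullet(\mathcal F,\nu)$ is the (unique if it exists) probability space $(\mathcal G,\rho)$ with $\mathcal G$ the smallest $\sigma$-algebra containing $\mathcal E$ and $\mathcal F$ and $\rho(E\cap F)=\mu(E)\nu(F)$ for all $E\in\mathcal E,F\in\mathcal F$; it is undefined if no such space exists. The operation $\bullet$ is associative and commutative as a partial operation. $\Gamma=x_1{:}S_1,\dots,x_k{:}S_k$ is a list of deterministic variables with sets $S_j$, and $[\![\Gamma]\!]=S_1\times\cdots\times S_k$; $\Delta=Y_1{:}B_1,\dots,Y_m{:}B_m$ is a list of random variables with measurable spaces $B_j$, and $[\![\Delta]\!]=B_1\times\cdots\times B_m$ (product measurable space). A random expression of type $A$ (a measurable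 space) over $\Gamma;\Delta$ is a function $E$ assigning to each $\gamma\in[\![\Gamma]\!]$ a measurable map $E(\gamma):[\![\Delta]\!]\to A$. A configuration over $\Gamma;\Delta$ is a triple $(\gamma,D,\mathcal P)$ with $\gamma\in[\![\Gamma]\!]$, $D:\Omega\to[\![\Delta]\!]$ a $\Sigma_\Omega$-measurable map, and $\mathcal P$ a probability space. Satisfaction: $\gamma,D,(\mathcal F,\mu)\vDash\mathsf{own}\,E$ iff $E(\gamma)\circ D$ is $\mathcal F$-measurable; $\gamma,D,\mathcal P\vDash P*Q$ iff there are $\mathcal P_P,\mathcal P_Q$ with $\mathcal P_P\bullet\mathcal P_Q$ defined, $\mathcal P_P\bullet\mathcal P_Q\sqsubseteq\mathcal P$, $\gamma,D,\mathcal P_P\vDash P$ and $\gamma,D,\mathcal P_Q\vDash Q$. "Mutually independent with respect to $\mathcal P=(\mathcal F,\mu)$" means that every $X_i'$ is $\mathcal F$-measurable and the family is mutually independent under $\mu$ in the usual sense. *)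

theory Defs
  imports "HOL-Probability.Probability"
begin

text \<open>
  The ambient measurable space is given by a value \<open>Om\<close> of type \<^typ>\<open>'w measure\<close> of which only
  \<^term>\<open>space Om\<close> and \<^term>\<open>sets Om\<close> are used; the same convention applies to the measurable
  spaces in contexts and to the types of random expressions. In contrast, a probability space
  \<open>(F, \<mu>)\<close> over \<open>Om\<close> is a single value of type \<^typ>\<open>'w measure\<close>, with its \<open>\<sigma>\<close>-algebra and its
  measure.
\<close>

definition prob_space_on :: "'w measure \<Rightarrow> 'w measure \<Rightarrow> bool" where
  "prob_space_on Om P \<longleftrightarrow> subalgebra Om P \<and> prob_space P"

definition psp_le :: "'w measure \<Rightarrow> 'w measure \<Rightarrow> bool"  (infix "\<sqsubseteq>\<^sub>p" 50) where
  "P \<sqsubseteq>\<^sub>p Q \<longleftrightarrow> subalgebra Q P \<and> (\<forall>E\<in>sets P. emeasure P E = emeasure Q E)"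

definition is_indep_comb :: "'w measure \<Rightarrow> 'w measure \<Rightarrow> 'w measure \<Rightarrow> 'w measure \<Rightarrow> bool" where
  "is_indep_comb Om P Q R \<longleftrightarrow>
     prob_space_on Om R \<and>
     sets R = sigma_sets (space Om) (sets P \<union> sets Q) \<and>
     (\<forall>E\<in>sets P. \<forall>F\<in>sets Q. emeasure R (E \<inter> F) = emeasure P E * emeasure Q F)"

text \<open>The partial operation \<open>\<bullet>\<close>; \<^term>\<open>None\<close> means undefined.\<close>

definition indep_comb :: "'w measure \<Rightarrow> 'w measure \<Rightarrow> 'w measure \<Rightarrow> 'w measure option" where
  "indep_comb Om P Q =
     (if \<exists>R. is_indep_comb Om P Q R then Some (THE R. is_indep_comb Om P Q R) else None)"

lemma is_indep_comb_unique:
  assumes P: "prob_space_on Om P" and Q: "prob_space_on Om Q"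
    and R: "is_indep_comb Om P Q R" and R': "is_indep_comb Om P Q R'"
  shows "R = R'"
proof -
  have sp: "space P = space Om" "space Q = space Om" "space R = space Om"
    using P Q R by (auto simp: prob_space_on_def is_indep_comb_def subalgebra_def)
  define G where "G = {E \<inter> F | E F. E \<in> sets P \<and> F \<in> sets Q}"
  have G_Pow: "G \<subseteq> Pow (space Om)"
    using sets.sets_into_space[of _ P] sp by (auto simp: G_def)
  have sub: "sets P \<union> sets Q \<subseteq> G"
  proof
    fix A assume "A \<in> sets P \<union> sets Q"
    then show "A \<in> G"
    proof
      assume A: "A \<in> sets P"
      then have "A = A \<inter> space Q" using sets.sets_into_space[OF A] sp by auto
      then show ?thesis using A unfolding G_def by blast
    next
      assume A: "A \<in> sets Q"
      then have "A = space P \<inter> A" using sets.sets_into_space[OF A] sp by auto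
      then show ?thesis using A unfolding G_def by blast
    qed
  qed
  have "G \<subseteq> sigma_sets (space Om) (sets P \<union> sets Q)"
  proof
    fix A assume "A \<in> G"
    then obtain E F where "A = E \<inter> F" "E \<in> sets P" "F \<in> sets Q" unfolding G_def by blast
    moreover have "sets R = sigma_sets (space Om) (sets P \<union> sets Q)"
      using R by (simp add: is_indep_comb_def)
    ultimately show "A \<in> sigma_sets (space Om) (sets P \<union> sets Q)"
      by (metis UnI1 UnI2 sets.Int sigma_sets.Basic)
  qed
  then have gen: "sigma_sets (space Om) (sets P \<union> sets Q) = sigma_sets (space Om) G"
    using sub by (intro sigma_sets_eqI) (auto intro: sigma_sets.Basic)
  show ?thesis
  proof (rule measure_eqI_generator_eq[where E = G and \<Omega> = "space Om" and A = "\<lambda>_. space Om"])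
    show "Int_stable G"
    proof (rule Int_stableI)
      fix a b assume "a \<in> G" "b \<in> G"
      then obtain E F E' F' where "a = E \<inter> F" "b = E' \<inter> F'"
        and *: "E \<in> sets P" "F \<in> sets Q" "E' \<in> sets P" "F' \<in> sets Q"
        unfolding G_def by blast
      then have "a \<inter> b = (E \<inter> E') \<inter> (F \<inter> F')" by auto
      then show "a \<inter> b \<in> G" using * unfolding G_def by blast
    qed
    show "range (\<lambda>_::nat. space Om) \<subseteq> G"
      using sub sets.top[of P] sp by auto
    show "emeasure R (space Om) \<noteq> \<infinity>" for i :: nat
      using R sp by (auto simp: is_indep_comb_def prob_space_on_def dest: prob_space.emeasure_space_1)
  qed (use G_Pow gen R R' in \<open>auto simp: is_indep_comb_def G_def\<close>)
qed

lemma indep_comb_eq_Some_iff: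
  assumes "prob_space_on Om P" "prob_space_on Om Q"
  shows "indep_comb Om P Q = Some R \<longleftrightarrow> is_indep_comb Om P Q R"
proof -
  have "(THE R. is_indep_comb Om P Q R) = R" if "is_indep_comb Om P Q R" for R
    using that is_indep_comb_unique[OF assms] by blast
  then show ?thesis
    unfolding indep_comb_def by auto
qed

text \<open>
  Contexts are positional: the names of the variables play no role in the semantics. The component
  sets and spaces are carved out of one type each, which is no restriction because any finite family
  of types embeds into their sum.
\<close>

type_synonym 's det_ctx = "'s set list"
type_synonym 'b rand_ctx = "'b measure list"

type_synonym 's det_val = "nat \<Rightarrow> 's"
type_synonym 'b rand_val = "nat \<Rightarrow> 'b"

definition det_sem :: "'s det_ctx \<Rightarrow> 's det_val set" where
  "det_sem \<Gamma> = (\<Pi>\<^sub>E j\<in>{..<length \<Gamma>}. \<Gamma> ! j)"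

definition rand_sem :: "'b rand_ctx \<Rightarrow> 'b rand_val measure" where
  "rand_sem \<Delta> = (\<Pi>\<^sub>M j\<in>{..<length \<Delta>}. \<Delta> ! j)"

type_synonym ('s, 'b, 'a) rexpr = "'s det_val \<Rightarrow> 'b rand_val \<Rightarrow> 'a"

definition rand_expr ::
    "'s det_ctx \<Rightarrow> 'b rand_ctx \<Rightarrow> 'a measure \<Rightarrow> ('s, 'b, 'a) rexpr \<Rightarrow> bool" where
  "rand_expr \<Gamma> \<Delta> A E \<longleftrightarrow> (\<forall>\<gamma>\<in>det_sem \<Gamma>. E \<gamma> \<in> rand_sem \<Delta> \<rightarrow>\<^sub>M A)"

definition configuration ::
    "'w measure \<Rightarrow> 's det_ctx \<Rightarrow> 'b rand_ctx \<Rightarrow>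
     's det_val \<Rightarrow> ('w \<Rightarrow> 'b rand_val) \<Rightarrow> 'w measure \<Rightarrow> bool" where
  "configuration Om \<Gamma> \<Delta> \<gamma> D P \<longleftrightarrow>
     \<gamma> \<in> det_sem \<Gamma> \<and> D \<in> Om \<rightarrow>\<^sub>M rand_sem \<Delta> \<and> prob_space_on Om P"

text \<open>
  \<open>Own A E\<close> carries the type \<open>A\<close> of the random expression \<open>E\<close>, because measurability of
  \<open>E \<gamma> \<circ> D\<close> refers to it.
\<close>

datatype ('s, 'b, 'a) fm =
    Own "'a measure" "('s, 'b, 'a) rexpr"
  | Sep "('s, 'b, 'a) fm" "('s, 'b, 'a) fm"  (infixr "\<^bold>*" 70)

primrec sat ::
    "'w measure \<Rightarrow> 's det_val \<Rightarrow> ('w \<Rightarrow> 'b rand_val) \<Rightarrow> 'w measure \<Rightarrow> ('s, 'b, 'a) fm \<Rightarrow> bool"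
where
  "sat Om \<gamma> D P (Own A E) \<longleftrightarrow> E \<gamma> \<circ> D \<in> P \<rightarrow>\<^sub>M A"
| "sat Om \<gamma> D P (\<phi> \<^bold>* \<psi>) \<longleftrightarrow>
     (\<exists>P1 P2 R. prob_space_on Om P1 \<and> prob_space_on Om P2 \<and>
        indep_comb Om P1 P2 = Some R \<and> R \<sqsubseteq>\<^sub>p P \<and>
        sat Om \<gamma> D P1 \<phi> \<and> sat Om \<gamma> D P2 \<psi>)"

text \<open>
  The iterated separating conjunction of a nonempty list of formulas, bracketed to the right. The
  bracketing does not affect satisfaction since \<open>\<bullet>\<close> is associative. The empty list is left
  unspecified.
\<close>

fun sep_list :: "('s, 'b, 'a) fm list \<Rightarrow> ('s, 'b, 'a) fm" where
  "sep_list [\<phi>] = \<phi>"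
| "sep_list (\<phi> # \<psi> # \<phi>s) = \<phi> \<^bold>* sep_list (\<psi> # \<phi>s)"

end

theory Submission
  imports Defs
begin

text \<open>
  Binary independent combination is independence of two sub-\<open>\<sigma>\<close>-algebras, and independence of
  \<open>X\<^sub>1, \<dots>, X\<^sub>n\<close> splits into independence of \<open>X\<^sub>2, \<dots>, X\<^sub>n\<close> together with independence of
  \<open>\<sigma>(X\<^sub>1)\<close> and \<open>\<sigma>(X\<^sub>2, \<dots>, X\<^sub>n)\<close>. The witnesses for \<open>*\<close> are the restrictions of \<open>\<P>\<close> to these two
  \<open>\<sigma>\<close>-algebras, and the theorem follows by induction on \<open>n\<close>.
\<close>

section \<open>Extension order and restriction of probability spaces\<close>

lemma psp_le_trans: "P \<sqsubseteq>\<^sub>p Q \<Longrightarrow> Q \<sqsubseteq>\<^sub>p R \<Longrightarrow> P \<sqsubseteq>\<^sub>p R"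
  unfolding psp_le_def subalgebra_def by auto

lemma psp_le_restr_to_subalg: "subalgebra M F \<Longrightarrow> restr_to_subalg M F \<sqsubseteq>\<^sub>p M"
  by (simp add: psp_le_def subalgebra_def emeasure_restr_to_subalg sets_restr_to_subalg
      space_restr_to_subalg)

lemma prob_space_on_restr_to_subalg:
  assumes "prob_space_on Om P" "subalgebra P F"
  shows "prob_space_on Om (restr_to_subalg P F)"
  using assms prob_space_restr_to_subalg[of P F]
  by (auto simp: prob_space_on_def subalgebra_def sets_restr_to_subalg space_restr_to_subalg)

lemma psp_le_space: "P \<sqsubseteq>\<^sub>p Q \<Longrightarrow> space P = space Q"
  and psp_le_sets: "P \<sqsubseteq>\<^sub>p Q \<Longrightarrow> B \<in> sets P \<Longrightarrow> B \<in> sets Q"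
  and psp_le_measure: "P \<sqsubseteq>\<^sub>p Q \<Longrightarrow> B \<in> sets P \<Longrightarrow> measure P B = measure Q B"
  by (auto simp: psp_le_def subalgebra_def measure_def)

lemma psp_le_measurable: "P \<sqsubseteq>\<^sub>p Q \<Longrightarrow> f \<in> P \<rightarrow>\<^sub>M N \<Longrightarrow> f \<in> Q \<rightarrow>\<^sub>M N"
  by (auto simp: psp_le_def intro: measurable_from_subalg)

text \<open>Independence involves only the probabilities of finite intersections of preimages. All
  of these lie in the smaller \<sigma>-algebra, because every \<open>X i\<close> is measurable for
  \<open>P\<close>, and the two measures agree there.\<close>

lemma indep_vars_psp_le_iff:
  assumes PQ: "P \<sqsubseteq>\<^sub>p Q" "prob_space P" "prob_space Q"
    and X: "\<And>i. i \<in> I \<Longrightarrow> X i \<in> P \<rightarrow>\<^sub>M A i"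
  shows "prob_space.indep_vars P A X I \<longleftrightarrow> prob_space.indep_vars Q A X I"
proof -
  interpret P: prob_space P by fact
  interpret Q: prob_space Q by fact
  note sp = psp_le_space[OF PQ(1)]
  \<comment> \<open>\<open>P\<close> and \<open>Q\<close> have the same underlying set, so one
    family of preimages serves both.\<close>
  define E where "E i = {X i -` B \<inter> space Q | B. B \<in> sets (A i)}" for i
  have EP: "E i \<subseteq> sets P" if "i \<in> I" for i
    using measurable_sets[OF X[OF that]] by (auto simp: E_def sp)
  then have EQ: "E i \<subseteq> sets Q" if "i \<in> I" for i
    using that psp_le_sets[OF PQ(1)] by blast
  have eq: "P.prob (\<Inter>j\<in>J. B j) = (\<Prod>j\<in>J. P.prob (B j)) \<longleftrightarrow>
      Q.prob (\<Inter>j\<in>J. B j) = (\<Prod>j\<in>J. Q.prob (B j))"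
    if "J \<subseteq> I" "J \<noteq> {}" "finite J" "B \<in> Pi J E" for J B
  proof -
    have B: "B j \<in> sets P" if "j \<in> J" for j
      using that \<open>J \<subseteq> I\<close> \<open>B \<in> Pi J E\<close> EP by blast
    then have "(\<Inter>j\<in>J. B j) \<in> sets P"
      using that by (intro sets.finite_INT) auto
    then show ?thesis
      using B by (simp add: psp_le_measure[OF PQ(1)])
  qed
  have "P.indep_sets E I \<longleftrightarrow> Q.indep_sets E I"
    unfolding P.indep_sets_def Q.indep_sets_def by (simp add: EP EQ eq cong: imp_cong ball_cong)
  moreover have "X i \<in> Q \<rightarrow>\<^sub>M A i" if "i \<in> I" for i
    using psp_le_measurable[OF PQ(1) X[OF that]] .
  ultimately show ?thesis
    by (simp add: P.indep_vars_def2 Q.indep_vars_def2 E_def[abs_def] sp X)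
qed

section \<open>Independent combination and independent sub-\<sigma>-algebras\<close>

text \<open>In the product formula, pair an event of one factor with the whole space of the other,
  which has mass 1.\<close>

lemma is_indep_comb_psp_le:
  assumes "prob_space_on Om P" "prob_space_on Om Q" "is_indep_comb Om P Q R"
  shows "P \<sqsubseteq>\<^sub>p R" "Q \<sqsubseteq>\<^sub>p R"
proof -
  have sp: "space P = space Om" "space Q = space Om" "space R = space Om"
    and one: "emeasure P (space Om) = 1" "emeasure Q (space Om) = 1"
    using assms prob_space.emeasure_space_1[of P] prob_space.emeasure_space_1[of Q]
    by (auto simp: is_indep_comb_def prob_space_on_def subalgebra_def)
  have mult: "emeasure R (E \<inter> F) = emeasure P E * emeasure Q F"
    if "E \<in> sets P" "F \<in> sets Q" for E F
    using assms(3) that by (simp add: is_indep_comb_def)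
  have "emeasure P E = emeasure R E" if "E \<in> sets P" for E
    using mult[OF that sets.top] sets.sets_into_space[OF that]
    by (simp add: sp one Int_absorb2)
  moreover have "emeasure Q F = emeasure R F" if "F \<in> sets Q" for F
    using mult[OF sets.top that] sets.sets_into_space[OF that]
    by (simp add: sp one Int_absorb1)
  moreover have "sets P \<subseteq> sets R" "sets Q \<subseteq> sets R"
    using assms(3) by (auto simp: is_indep_comb_def)
  ultimately show "P \<sqsubseteq>\<^sub>p R" "Q \<sqsubseteq>\<^sub>p R"
    by (auto simp: psp_le_def subalgebra_def sp)
qed

text \<open>The witness is \<open>P\<close> restricted to the \<sigma>-algebra generated by
  \<open>F\<close> and \<open>G\<close>. Its product formula is the independence of \<open>F\<close>
  and \<open>G\<close> under \<open>P\<close>.\<close>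

lemma is_indep_comb_restr_to_subalg:
  assumes P: "prob_space_on Om P" and F: "subalgebra P F" and G: "subalgebra P G"
    and indep: "prob_space.indep_set P (sets F) (sets G)"
  shows "\<exists>R. is_indep_comb Om (restr_to_subalg P F) (restr_to_subalg P G) R \<and> R \<sqsubseteq>\<^sub>p P"
proof -
  interpret prob_space P using P by (simp add: prob_space_on_def)
  have sp: "space P = space Om" using P by (simp add: prob_space_on_def subalgebra_def)
  define H where "H = sigma (space P) (sets F \<union> sets G)"
  have sub: "sets F \<union> sets G \<subseteq> sets P"
    using F G by (auto simp: subalgebra_def)
  then have sets_H: "sets H = sigma_sets (space P) (sets F \<union> sets G)"
    unfolding H_def using sets.space_closed by (intro sets_measure_of) blast
  have H: "subalgebra P H"
    unfolding subalgebra_def sets_H using sets.sigma_sets_subset[OF sub]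
    by (simp add: H_def space_measure_of_conv)
  have "emeasure (restr_to_subalg P H) (E \<inter> E') =
      emeasure (restr_to_subalg P F) E * emeasure (restr_to_subalg P G) E'"
    if "E \<in> sets F" "E' \<in> sets G" for E E'
  proof -
    have "E \<inter> E' \<in> sets H"
      using that by (intro sets.Int) (auto simp: sets_H)
    then show ?thesis
      using that indep_setD[OF indep that]
      by (simp add: emeasure_restr_to_subalg F G H emeasure_eq_measure ennreal_mult)
  qed
  then have "is_indep_comb Om (restr_to_subalg P F) (restr_to_subalg P G) (restr_to_subalg P H)"
    using prob_space_on_restr_to_subalg[OF P H]
    by (auto simp: is_indep_comb_def sets_restr_to_subalg F G H sets_H sp)
  then show ?thesis
    using psp_le_restr_to_subalg[OF H] by blast
qed

section \<open>Splitting off one random variable\<close>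

text \<open>Forward half of the induction step. Independence of the variables is lifted to
  independence of two generated \<sigma>-algebras, and restricting \<open>P\<close> to each of them
  gives \<open>P1\<close> and \<open>P2\<close>.\<close>

lemma indep_vars_insert_imp_indep_comb:
  assumes P: "prob_space_on Om P" and i: "i \<notin> J"
    and indep: "prob_space.indep_vars P A X (insert i J)"
  shows "\<exists>P1 P2 R. prob_space_on Om P1 \<and> prob_space_on Om P2 \<and> is_indep_comb Om P1 P2 R \<and>
    R \<sqsubseteq>\<^sub>p P \<and> X i \<in> P1 \<rightarrow>\<^sub>M A i \<and> prob_space.indep_vars P2 A X J"
proof -
  interpret prob_space P using P by (simp add: prob_space_on_def)
  define E where "E k = {X k -` B \<inter> space P | B. B \<in> sets (A k)}" for k
  have rv: "random_variable (A k) (X k)" if "k \<in> insert i J" for k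
    using indep that by (auto simp: indep_vars_def2)
  have E: "E k \<subseteq> sets P" if "k \<in> insert i J" for k
    using measurable_sets[OF rv[OF that]] by (auto simp: E_def)
  \<comment> \<open>The \<sigma>-algebra generated by the variables with index in \<open>K\<close>;
    it is used at \<open>{i}\<close> and at \<open>J\<close>.\<close>
  define S where "S K = sigma (space P) (\<Union>k\<in>K. E k)" for K
  have space_S: "space (S K) = space P" for K
    by (simp add: S_def space_measure_of_conv)
  have sets_S: "sets (S K) = sigma_sets (space P) (\<Union>k\<in>K. E k)" for K
    unfolding S_def by (rule sets_measure_of) (auto simp: E_def)
  have S: "subalgebra P (S K)" if "K \<subseteq> insert i J" for K
    unfolding subalgebra_def sets_S space_S
    using E that by (intro conjI sets.sigma_sets_subset UN_least) auto
  have meas: "X k \<in> restr_to_subalg P (S K) \<rightarrow>\<^sub>M A k" if "k \<in> K" "K \<subseteq> insert i J" for k K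
  proof (rule measurable_in_subalg[OF S[OF that(2)]], rule measurableI)
    show "X k x \<in> space (A k)" if "x \<in> space (S K)" for x
      using that measurable_space[OF rv] \<open>k \<in> K\<close> \<open>K \<subseteq> insert i J\<close> by (auto simp: space_S)
    show "X k -` B \<inter> space (S K) \<in> sets (S K)" if "B \<in> sets (A k)" for B
      unfolding sets_S space_S using that \<open>k \<in> K\<close> by (intro sigma_sets.Basic) (auto simp: E_def)
  qed
  \<comment> \<open>Grouping the indices into the disjoint blocks \<open>{i}\<close> and
    \<open>J\<close> preserves independence, since the generators are closed under intersection. The
    blocks are indexed by \<open>bool\<close> because \<open>indep_set\<close> is defined through
    \<open>case_bool\<close>.\<close>
  have "indep_sets (\<lambda>b. sigma_sets (space P) (\<Union>k\<in>case_bool {i} J b. E k)) UNIV"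
  proof (rule indep_sets_collect_sigma)
    show "indep_sets E (\<Union>b. case_bool {i} J b)"
      using indep by (simp add: indep_vars_def2 E_def[abs_def] UNIV_bool Un_commute)
    show "Int_stable (E k)" for k
    proof (rule Int_stableI)
      fix a b assume "a \<in> E k" "b \<in> E k"
      then obtain B C where "a = X k -` B \<inter> space P" "b = X k -` C \<inter> space P"
        "B \<in> sets (A k)" "C \<in> sets (A k)"
        by (auto simp: E_def)
      moreover from this have "a \<inter> b = X k -` (B \<inter> C) \<inter> space P" by auto
      ultimately show "a \<inter> b \<in> E k" unfolding E_def by blast
    qed
    show "disjoint_family_on (case_bool {i} J) UNIV"
      using i by (auto simp: disjoint_family_on_def split: bool.splits)
  qed
  then have "indep_set (sets (S {i})) (sets (S J))"
    unfolding indep_set_def sets_S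
    by (rule indep_sets_cong[THEN iffD1, rotated 2]) (auto split: bool.splits)
  with P S obtain R
    where R: "is_indep_comb Om (restr_to_subalg P (S {i})) (restr_to_subalg P (S J)) R" "R \<sqsubseteq>\<^sub>p P"
    using is_indep_comb_restr_to_subalg[of Om P "S {i}" "S J"] by blast
  have "indep_vars A X J"
    using indep by (rule indep_vars_subset) auto
  \<comment> \<open>The variables over \<open>J\<close> are measurable for the restriction, so their
    independence descends to it from \<open>P\<close>.\<close>
  then have "prob_space.indep_vars (restr_to_subalg P (S J)) A X J"
    using meas[of _ J] S[of J] prob_space_axioms
    by (subst indep_vars_psp_le_iff[where Q = P])
      (auto intro: psp_le_restr_to_subalg prob_space_restr_to_subalg)
  then show ?thesis
    using R meas[of i "{i}"] S[of "{i}"] S[of J] prob_space_on_restr_to_subalg[OF P] by blast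
qed

text \<open>Backward half of the induction step. In a finite intersection of preimages, the event
  for \<open>i\<close> lies in \<open>P1\<close> and the intersection of the others in
  \<open>P2\<close>. The product formula splits off the factor for \<open>i\<close>, and
  independence over \<open>J\<close> factors the rest.\<close>

lemma indep_comb_imp_indep_vars_insert:
  assumes P: "prob_space P" and P1: "prob_space_on Om P1" and P2: "prob_space_on Om P2"
    and R: "is_indep_comb Om P1 P2 R" and RP: "R \<sqsubseteq>\<^sub>p P" and i: "i \<notin> J"
    and Xi: "X i \<in> P1 \<rightarrow>\<^sub>M A i" and indep: "prob_space.indep_vars P2 A X J"
  shows "prob_space.indep_vars P A X (insert i J)"
proof -
  interpret P: prob_space P by fact
  interpret P2: prob_space P2 using P2 by (simp add: prob_space_on_def)
  interpret P1: prob_space P1 using P1 by (simp add: prob_space_on_def)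
  interpret R: prob_space R using R by (simp add: is_indep_comb_def prob_space_on_def)
  note le1 = psp_le_trans[OF is_indep_comb_psp_le(1)[OF P1 P2 R] RP]
    and le2 = psp_le_trans[OF is_indep_comb_psp_le(2)[OF P1 P2 R] RP]
  note sp = psp_le_space[OF le1] psp_le_space[OF le2]
  have X2: "X j \<in> P2 \<rightarrow>\<^sub>M A j" if "j \<in> J" for j
    using indep that by (simp add: P2.indep_vars_def2)
  \<comment> \<open>The product formula of \<open>R\<close>, moved to \<open>P\<close> because
    \<open>R\<close>, \<open>P1\<close> and \<open>P2\<close> all lie below
    \<open>P\<close>.\<close>
  have mult: "P.prob (B \<inter> C) = P.prob B * P.prob C" if "B \<in> sets P1" "C \<in> sets P2" for B C
  proof -
    have "B \<inter> C \<in> sets R"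
      using R that is_indep_comb_psp_le[OF P1 P2 R] by (intro sets.Int) (auto dest: psp_le_sets)
    moreover have "R.prob (B \<inter> C) = P1.prob B * P2.prob C"
      using R that unfolding is_indep_comb_def
      by (simp add: measure_def enn2real_mult)
    ultimately show ?thesis
      using that by (simp add: psp_le_measure[OF RP] psp_le_measure[OF le1] psp_le_measure[OF le2])
  qed
  define E where "E k = {X k -` B \<inter> space P | B. B \<in> sets (A k)}" for k
  have E1: "E i \<subseteq> sets P1"
    using measurable_sets[OF Xi] by (auto simp: E_def sp)
  have E2: "E j \<subseteq> sets P2" if "j \<in> J" for j
    using measurable_sets[OF X2[OF that]] by (auto simp: E_def sp)
  have "P.indep_vars A X J"
    using indep X2 indep_vars_psp_le_iff[OF le2 P2.prob_space_axioms P] by blast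
  then have indepJ: "P.indep_sets E J"
    by (simp add: P.indep_vars_def2 E_def[abs_def])
  have "P.indep_sets E (insert i J)"
  proof (rule P.indep_setsI)
    show "E k \<subseteq> sets P" if "k \<in> insert i J" for k
      using that E1 E2 psp_le_sets[OF le1] psp_le_sets[OF le2] by blast
  next
    fix B K assume K: "K \<noteq> {}" "K \<subseteq> insert i J" "finite K" and B: "\<forall>k\<in>K. B k \<in> E k"
    define L where "L = K - {i}"
    have L: "L \<subseteq> J" "finite L" "i \<notin> L" "\<forall>k\<in>L. B k \<in> E k"
      using K B by (auto simp: L_def)
    have prodL: "P.prob (\<Inter>k\<in>L. B k) = (\<Prod>k\<in>L. P.prob (B k))" if "L \<noteq> {}"
      using L that by (intro P.indep_setsD[OF indepJ]) auto
    show "P.prob (\<Inter>k\<in>K. B k) = (\<Prod>k\<in>K. P.prob (B k))"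
    \<comment> \<open>The intersection over an empty \<open>L\<close> would be \<open>UNIV\<close>,
      which need not be an event, so \<open>{i}\<close> is treated apart.\<close>
    proof (cases "i \<in> K \<and> L \<noteq> {}")
      case True
      then have K_eq: "K = insert i L" by (auto simp: L_def)
      have "(\<Inter>k\<in>L. B k) \<in> sets P2"
        using L True E2 by (intro sets.finite_INT) auto
      moreover have "B i \<in> sets P1"
        using B True E1 by auto
      ultimately show ?thesis
        using L True prodL by (simp add: K_eq mult)
    next
      case False
      then have "K = L \<or> K = {i}" by (auto simp: L_def)
      then show ?thesis using prodL K by auto
    qed
  qed
  moreover have "X k \<in> P \<rightarrow>\<^sub>M A k" if "k \<in> insert i J" for k
    using that Xi X2 psp_le_measurable[OF le1] psp_le_measurable[OF le2] by blast
  ultimately show ?thesis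
    by (simp add: P.indep_vars_def2 E_def[abs_def])
qed

section \<open>Induction on the list of variables\<close>

lemma (in prob_space) indep_vars_singleton_iff:
  "indep_vars A X {i} \<longleftrightarrow> random_variable (A i) (X i)"
proof -
  have "indep_sets (\<lambda>i. {X i -` B \<inter> space M | B. B \<in> sets (A i)}) {i}"
    if "random_variable (A i) (X i)"
  proof (rule indep_setsI)
    fix B J assume "J \<noteq> {}" "J \<subseteq> {i}"
    then have "J = {i}" by blast
    then show "prob (\<Inter>j\<in>J. B j) = (\<Prod>j\<in>J. prob (B j))" by simp
  qed (use measurable_sets[OF that] in auto)
  then show ?thesis
    by (auto simp: indep_vars_def2)
qed

text \<open>Index lists replace \<open>{1..n}\<close> so that the tail is again an instance, and
  \<open>P\<close> is arbitrary because the tail is satisfied in \<open>P2\<close>. Distinctness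
  keeps the head index out of the tail, as both halves of the step require.\<close>

lemma indep_vars_iff_sat_sep_list:
  assumes "is \<noteq> []" "distinct is" "prob_space_on Om P"
  shows "prob_space.indep_vars P A (\<lambda>i. X i \<gamma> \<circ> D) (set is) \<longleftrightarrow>
    sat Om \<gamma> D P (sep_list (map (\<lambda>i. Own (A i) (X i)) is))"
  using assms
proof (induction "is" arbitrary: P rule: list_nonempty_induct)
  case (single i)
  then interpret prob_space P by (simp add: prob_space_on_def)
  show ?case by (simp add: indep_vars_singleton_iff comp_def)
next
  case (cons i js)
  have P: "prob_space P" and i: "i \<notin> set js" and js: "distinct js"
    using cons.prems by (simp_all add: prob_space_on_def)
  \<comment> \<open>\<open>sep_list\<close> splits only lists with at least two entries, hence the
    case distinction on \<open>js\<close>.\<close>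
  have "sep_list (map (\<lambda>i. Own (A i) (X i)) (i # js)) =
      Own (A i) (X i) \<^bold>* sep_list (map (\<lambda>i. Own (A i) (X i)) js)"
    using \<open>js \<noteq> []\<close> by (cases js) auto
  \<comment> \<open>The induction hypothesis and \<open>indep_comb_eq_Some_iff\<close> need
    \<open>P1\<close> and \<open>P2\<close> to be probability spaces over \<open>Om\<close>;
    \<open>conj_cong\<close> supplies this from the leading conjuncts.\<close>
  then have "sat Om \<gamma> D P (sep_list (map (\<lambda>i. Own (A i) (X i)) (i # js))) \<longleftrightarrow>
      (\<exists>P1 P2 R. prob_space_on Om P1 \<and> prob_space_on Om P2 \<and> is_indep_comb Om P1 P2 R \<and>
        R \<sqsubseteq>\<^sub>p P \<and> X i \<gamma> \<circ> D \<in> P1 \<rightarrow>\<^sub>M A i \<and>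
        prob_space.indep_vars P2 A (\<lambda>i. X i \<gamma> \<circ> D) (set js))"
    by (simp add: cons.IH[OF js] indep_comb_eq_Some_iff cong: conj_cong)
  also have "\<dots> \<longleftrightarrow> prob_space.indep_vars P A (\<lambda>i. X i \<gamma> \<circ> D) (insert i (set js))"
    using indep_vars_insert_imp_indep_comb[OF cons.prems(2) i, of A "\<lambda>i. X i \<gamma> \<circ> D"]
      indep_comb_imp_indep_vars_insert[OF P _ _ _ _ i, where X = "\<lambda>i. X i \<gamma> \<circ> D" and A = A]
    by blast
  finally show ?case by (simp add: comp_def)
qed

theorem lemma2p5:
  fixes Om P :: "'w measure"
    and \<Gamma> :: "'s det_ctx" and \<Delta> :: "'b rand_ctx"
    and \<gamma> :: "'s det_val" and D :: "'w \<Rightarrow> 'b rand_val"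
    and n :: nat and A :: "nat \<Rightarrow> 'a measure" and X :: "nat \<Rightarrow> ('s, 'b, 'a) rexpr"
  assumes "configuration Om \<Gamma> \<Delta> \<gamma> D P"
    and "n \<ge> 1"
    and "\<And>i. i \<in> {1..n} \<Longrightarrow> rand_expr \<Gamma> \<Delta> (A i) (X i)"
  shows "prob_space.indep_vars P A (\<lambda>i. X i \<gamma> \<circ> D) {1..n} \<longleftrightarrow>
         sat Om \<gamma> D P (sep_list (map (\<lambda>i. Own (A i) (X i)) [1..<n+1]))"
proof -
  \<comment> \<open>The upper bound of the list is exclusive; \<open>n \<ge> 1\<close> makes the
    list nonempty.\<close>
  have "set [1..<n+1] = {1..n}" by auto
  moreover have "prob_space_on Om P"
    using assms(1) by (simp add: configuration_def)
  ultimately show ?thesis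
    using indep_vars_iff_sat_sep_list[of "[1..<n+1]" Om P A X \<gamma> D] assms(2) by simp
qed

end
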